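(* Let $\beta=(\beta_{ij})_{i,j\ge 0,\ i+j\le 6}$ be a real sequence such that $\mathcal M(3)(\beta)$ is positive semidefinite, $\mathcal M(2)(\beta)$ is positive definite, and $\operatorname{rank}\mathcal M(3)=\operatorname{card}\mathcal V=7$, where $\mathcal V=\{(x_1,y_1),\dots,(x_7,y_7)\}$ is the algebraic variety of $\mathcal M(3)$. Suppose the columns $\mathcal B_1=\{1,X,Y,X^2,XY,Y^2,X^3\}$ form a basis of the column space of $\mathcal M(3)$. Then $\beta$ has a representing measure if and only if $\mathcal M(3)$ is weakly consistent and, for all $i,j\ge0$ with $0\le i+j\le 2$, $$\Lambda_\beta\big(x^iy^j(x^4-a_{00}-a_{10}x-a_{01}y-a_{20}x^2-a_{11}xy-a_{02}y^2-a_{30}x^3)\big)=0,$$ where $(a_{00},a_{10},a_{01},a_{20},a_{11},a_{02},a_{30})^T=W_{\mathcal B_1}^{-1}(x_1^4,\dots,x_7^4)^T$.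
   Context: The moment matrix $\mathcal M(3)(\beta)$ has rows and columns indexed by $1,X,Y,X^2,XY,Y^2,X^3,X^2Y,XY^2,Y^3$ in this order, with entry $\beta_{i+k,j+l}$ in row $X^iY^j$ and column $X^kY^l$; $\mathcal M(2)(\beta)$ is its principal submatrix indexed by monomials of degree $\le 2$. For $p(x,y)=\sum a_{ij}x^iy^j$ of degree $\le 3$, $p(X,Y)=\sum a_{ij}X^iY^j$ is the corresponding linear combination of columns. The algebraic variety is $\mathcal V=\bigcap\{\mathcal Z(p):\deg p\le 3,\ p(X,Y)=\mathbf 0\}$ with $\mathcal Z(p)$ the real zero set of $p$. The Riesz functional $\Lambda_\beta$ on polynomials of degree $\le 6$ is $\Lambda_\beta(\sum a_{ij}x^iy^j)=\sum a_{ij}\beta_{ij}$. A representing measure is a positive Borel measure $\mu$ on $\mathbb R^2$ with $\beta_{ij}=\int x^iy^j\,d\mu$ for $i+j\le 6$. $\mathcal M(3)$ (or $\beta$) is weakly consistent if every polynomial $p$ of degree $\le 3$ vanishing on $\mathcal V$ satisfies $p(X,Y)=\mathbf 0$. The generalized Vandermonde matrix $W$ is the $7\times 10$ matrix whose $k$-th row is $(1,x_k,y_k,x_k^2,x_ky_k,y_k^2,x_k^3,x_k^2y_k,x_ky_k^2,y_k^3)$, with columns labeled $1,X,Y,\dots,Y^3$; for a set $\mathcal B$ of column labels, $W_{\mathcal B}$ is the submatrix of $W$ consisting of the columns in $\mathcal B$ (in the given order). *)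

theory Defs
  imports "HOL-Analysis.Analysis"
begin

datatype mon = M_1 | M_X | M_Y | M_X2 | M_XY | M_Y2 | M_X3 | M_X2Y | M_XY2 | M_Y3

lemma UNIV_mon: "(UNIV :: mon set) = {M_1, M_X, M_Y, M_X2, M_XY, M_Y2, M_X3, M_X2Y, M_XY2, M_Y3}"
  using mon.exhaust by auto

instance mon :: finite
  by standard (simp add: UNIV_mon)

fun expo :: "mon \<Rightarrow> nat \<times> nat" where
  "expo M_1 = (0,0)" | "expo M_X = (1,0)" | "expo M_Y = (0,1)"
| "expo M_X2 = (2,0)" | "expo M_XY = (1,1)" | "expo M_Y2 = (0,2)"
| "expo M_X3 = (3,0)" | "expo M_X2Y = (2,1)" | "expo M_XY2 = (1,2)" | "expo M_Y3 = (0,3)"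

datatype mon2 = N_1 | N_X | N_Y | N_X2 | N_XY | N_Y2

lemma UNIV_mon2: "(UNIV :: mon2 set) = {N_1, N_X, N_Y, N_X2, N_XY, N_Y2}"
  using mon2.exhaust by auto

instance mon2 :: finite
  by standard (simp add: UNIV_mon2)

fun emb2 :: "mon2 \<Rightarrow> mon" where
  "emb2 N_1 = M_1" | "emb2 N_X = M_X" | "emb2 N_Y = M_Y"
| "emb2 N_X2 = M_X2" | "emb2 N_XY = M_XY" | "emb2 N_Y2 = M_Y2"

datatype b1 = B_1 | B_X | B_Y | B_X2 | B_XY | B_Y2 | B_X3

lemma UNIV_b1: "(UNIV :: b1 set) = {B_1, B_X, B_Y, B_X2, B_XY, B_Y2, B_X3}"
  using b1.exhaust by auto

instance b1 :: finite
  by standard (simp add: UNIV_b1)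

fun embB1 :: "b1 \<Rightarrow> mon" where
  "embB1 B_1 = M_1" | "embB1 B_X = M_X" | "embB1 B_Y = M_Y"
| "embB1 B_X2 = M_X2" | "embB1 B_XY = M_XY" | "embB1 B_Y2 = M_Y2" | "embB1 B_X3 = M_X3"

text \<open>A sequence beta_{ij} (only i+j <= 6 is used) is a function nat => nat => real.\<close>

definition M3 :: "(nat \<Rightarrow> nat \<Rightarrow> real) \<Rightarrow> real^mon^mon" where
  "M3 \<beta> = (\<chi> r c. \<beta> (fst (expo r) + fst (expo c)) (snd (expo r) + snd (expo c)))"

definition M2 :: "(nat \<Rightarrow> nat \<Rightarrow> real) \<Rightarrow> real^mon2^mon2" where
  "M2 \<beta> = (\<chi> r c. M3 \<beta> $ emb2 r $ emb2 c)"

definition psd_mat :: "real^'n^'n \<Rightarrow> bool" where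
  "psd_mat A \<longleftrightarrow> transpose A = A \<and> (\<forall>v. 0 \<le> v \<bullet> (A *v v))"

definition pd_mat :: "real^'n^'n \<Rightarrow> bool" where
  "pd_mat A \<longleftrightarrow> transpose A = A \<and> (\<forall>v. v \<noteq> 0 \<longrightarrow> 0 < v \<bullet> (A *v v))"

definition mon_eval :: "mon \<Rightarrow> real \<times> real \<Rightarrow> real" where
  "mon_eval m z = fst z ^ fst (expo m) * snd z ^ snd (expo m)"

definition peval :: "real^mon \<Rightarrow> real \<times> real \<Rightarrow> real" where
  "peval p z = (\<Sum>m\<in>UNIV. p $ m * mon_eval m z)"

definition pXY :: "(nat \<Rightarrow> nat \<Rightarrow> real) \<Rightarrow> real^mon \<Rightarrow> real^mon" where
  "pXY \<beta> p = (\<Sum>m\<in>UNIV. p $ m *\<^sub>R column m (M3 \<beta>))"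

definition zero_set :: "real^mon \<Rightarrow> (real \<times> real) set" where
  "zero_set p = {z. peval p z = 0}"

definition variety :: "(nat \<Rightarrow> nat \<Rightarrow> real) \<Rightarrow> (real \<times> real) set" where
  "variety \<beta> = \<Inter> {zero_set p | p. pXY \<beta> p = 0}"

definition weakly_consistent :: "(nat \<Rightarrow> nat \<Rightarrow> real) \<Rightarrow> bool" where
  "weakly_consistent \<beta> \<longleftrightarrow>
     (\<forall>p. (\<forall>z\<in>variety \<beta>. peval p z = 0) \<longrightarrow> pXY \<beta> p = 0)"

text \<open>polynomials of degree <= 6 as coefficient functions q i j (coefficient of x^i y^j)\<close>
definition riesz :: "(nat \<Rightarrow> nat \<Rightarrow> real) \<Rightarrow> (nat \<Rightarrow> nat \<Rightarrow> real) \<Rightarrow> real" where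
  "riesz \<beta> q = (\<Sum>i\<le>6. \<Sum>j\<le>6-i. q i j * \<beta> i j)"

definition has_rep_measure :: "(nat \<Rightarrow> nat \<Rightarrow> real) \<Rightarrow> bool" where
  "has_rep_measure \<beta> \<longleftrightarrow> (\<exists>\<mu> :: (real \<times> real) measure. sets \<mu> = sets borel \<and>
     (\<forall>i j. i + j \<le> 6 \<longrightarrow> integrable \<mu> (\<lambda>(x,y). x ^ i * y ^ j) \<and>
                          (\<integral>(x,y). x ^ i * y ^ j \<partial>\<mu>) = \<beta> i j))"

text \<open>W restricted to columns B1; rows indexed by an enumeration pts of the 7 points\<close>
definition W_B1 :: "(7 \<Rightarrow> real \<times> real) \<Rightarrow> real^b1^7" where
  "W_B1 pts = (\<chi> k c. mon_eval (embB1 c) (pts k))"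

text \<open>coefficients of x^i y^j (x^4 - a00 - a10 x - ... - a30 x^3)\<close>
definition test_poly :: "nat \<Rightarrow> nat \<Rightarrow> real^b1 \<Rightarrow> nat \<Rightarrow> nat \<Rightarrow> real" where
  "test_poly i j a = (\<lambda>m n. (if m = i + 4 \<and> n = j then 1 else 0)
      - (\<Sum>c\<in>UNIV. a $ c * (if m = i + fst (expo (embB1 c)) \<and> n = j + snd (expo (embB1 c))
                              then 1 else 0)))"

end

theory Submission
  imports Defs
begin

text \<open>
  Weak consistency makes \<open>W\<close> restricted to the basic monomials invertible, so there are unique
  weights at the seven points reproducing the moments of the basic monomials. The column relations
  express \<open>x\<^sup>2y\<close>, \<open>xy\<^sup>2\<close>, \<open>y\<^sup>3\<close> through basic monomials, and the test condition does so for \<open>x\<^sup>4\<close>;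
  these relations hold for \<open>\<beta>\<close> as well as on the points, and they reduce every monomial of degree at
  most 6 to basic ones. Hence the atomic functional agrees with the Riesz functional, and
  positivity on squares of interpolation polynomials makes the weights nonnegative.
  Conversely, a representing measure is concentrated on the variety, because \<open>p\<^sup>2\<close> integrates to 0
  whenever \<open>p(X,Y) = 0\<close>.
\<close>

section \<open>Monomials, columns and evaluation of polynomials\<close>

lemma CARD_b1: "CARD(b1) = 7"
  by (simp add: UNIV_b1)

lemma fst_snd_expo_le: "fst (expo m) + snd (expo m) \<le> 3"
  by (cases m) auto

lemma expo_surj:
  assumes "s + t \<le> 3"
  obtains m where "expo m = (s, t)"
proof -
  have "(s, t) \<in> {(0,0),(1,0),(0,1),(2,0),(1,1),(0,2),(3,0),(2,1),(1,2),(0,3)}"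
    using assms unfolding insert_iff prod.inject empty_iff by presburger
  then have "(s, t) \<in> expo ` UNIV"
    by (simp only: UNIV_mon image_insert image_empty expo.simps)
  then show thesis
    using that by auto
qed

text \<open>Entry \<open>r\<close> is the Riesz functional of the monomial \<open>r\<close> times
  \<open>p\<close>, so a column relation is a family of linear relations between moments, one for
  each row.\<close>

lemma pXY_nth:
  "pXY \<beta> p $ r =
    (\<Sum>m\<in>UNIV. p $ m * \<beta> (fst (expo r) + fst (expo m)) (snd (expo r) + snd (expo m)))"
  by (simp add: pXY_def column_def M3_def)

lemma linear_pXY: "linear (pXY \<beta>)"
  by (rule linearI)
    (simp_all add: pXY_def scaleR_add_left sum.distrib scaleR_sum_right)

lemma linear_peval: "linear (\<lambda>p. peval p z)"
  by (rule linearI)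
    (simp_all add: peval_def distrib_right sum.distrib sum_distrib_left mult.assoc)

text \<open>With basic coefficient vectors embedded among all ten coefficients, the same vector can
  be read as a combination of columns through \<open>pXY\<close> and as a function on the points
  through \<open>peval\<close>.\<close>

definition poly_B1 :: "real^b1 \<Rightarrow> real^mon" where
  "poly_B1 u = (\<Sum>c\<in>UNIV. u $ c *\<^sub>R axis (embB1 c) 1)"

lemma pXY_axis: "pXY \<beta> (axis m 1) = column m (M3 \<beta>)"
  by (simp add: pXY_def axis_def if_distrib[where f = "\<lambda>x. x *\<^sub>R _"] cong: if_cong)

lemma peval_axis: "peval (axis m 1) z = mon_eval m z"
  by (simp add: peval_def axis_def if_distrib[where f = "\<lambda>x. x * _"] cong: if_cong)

lemma pXY_poly_B1: "pXY \<beta> (poly_B1 u) = (\<Sum>c\<in>UNIV. u $ c *\<^sub>R column (embB1 c) (M3 \<beta>))"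
  by (simp add: poly_B1_def linear_sum[OF linear_pXY] linear_cmul[OF linear_pXY] pXY_axis)

lemma peval_poly_B1: "peval (poly_B1 u) z = (\<Sum>c\<in>UNIV. u $ c * mon_eval (embB1 c) z)"
  by (simp add: poly_B1_def linear_sum[OF linear_peval] linear_cmul[OF linear_peval] peval_axis)

lemma W_B1_mult_nth: "(W_B1 pts *v u) $ k = peval (poly_B1 u) (pts k)"
  by (simp add: W_B1_def matrix_vector_mult_def peval_poly_B1 mult.commute)

text \<open>Every monomial of the test polynomial has degree at most 6 because
  \<open>i + j \<le> 2\<close>, so the bounded double sum in \<open>riesz\<close> cuts off no
  coefficient.\<close>

lemma riesz_test_poly:
  assumes "i + j \<le> 2"
  shows "riesz \<beta> (test_poly i j a) = \<beta> (i + 4) j -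
    (\<Sum>c\<in>UNIV. a $ c * \<beta> (i + fst (expo (embB1 c))) (j + snd (expo (embB1 c))))"
proof -
  have delta: "(\<Sum>i\<le>6. \<Sum>j\<le>6-i. (if i = m \<and> j = n then 1 else 0) * \<beta> i j) = \<beta> m n"
    if "m + n \<le> 6" for m n :: nat
  proof -
    have "(\<Sum>i\<le>6. \<Sum>j\<le>6-i. (if i = m \<and> j = n then 1 else 0) * \<beta> i j)
      = (\<Sum>i\<le>6. if i = m then (\<Sum>j\<le>6-i. if j = n then \<beta> i j else 0) else 0)"
      by (intro sum.cong refl) (auto simp: if_distrib[where f = "\<lambda>x. x * _"] cong: if_cong)
    also have "\<dots> = \<beta> m n"
      using that by simp
    finally show ?thesis .
  qed
  have bound: "i + fst (expo (embB1 c)) + (j + snd (expo (embB1 c))) \<le> 6" for c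
    using assms fst_snd_expo_le[of "embB1 c"] by linarith
  have "riesz \<beta> (test_poly i j a) =
      (\<Sum>m\<le>6. \<Sum>n\<le>6-m. (if m = i + 4 \<and> n = j then 1 else 0) * \<beta> m n) -
      (\<Sum>m\<le>6. \<Sum>n\<le>6-m. \<Sum>c\<in>UNIV. a $ c * ((if m = i + fst (expo (embB1 c)) \<and>
          n = j + snd (expo (embB1 c)) then 1 else 0) * \<beta> m n))"
    unfolding riesz_def test_poly_def
    by (simp only: left_diff_distrib sum_subtractf sum_distrib_right mult.assoc)
  also have "(\<Sum>m\<le>6. \<Sum>n\<le>6-m. \<Sum>c\<in>UNIV. a $ c * ((if m = i + fst (expo (embB1 c)) \<and>
          n = j + snd (expo (embB1 c)) then 1 else 0) * \<beta> m n)) =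
      (\<Sum>c\<in>UNIV. a $ c * (\<Sum>m\<le>6. \<Sum>n\<le>6-m. (if m = i + fst (expo (embB1 c)) \<and>
          n = j + snd (expo (embB1 c)) then 1 else 0) * \<beta> m n))"
    unfolding sum_distrib_left
    by (subst sum.swap[of _ _ "{..6 - _}"], subst sum.swap) simp
  finally show ?thesis
    using assms delta[of "i + 4" j] delta[OF bound] by simp
qed

lemma in_variety_iff: "z \<in> variety \<beta> \<longleftrightarrow> (\<forall>p. pXY \<beta> p = 0 \<longrightarrow> peval p z = 0)"
  by (auto simp: variety_def zero_set_def)

section \<open>Consequences of a representing measure\<close>

locale rep_measure =
  fixes \<beta> :: "nat \<Rightarrow> nat \<Rightarrow> real" and \<mu> :: "(real \<times> real) measure"
  assumes sets_rep [measurable_cong]: "sets \<mu> = sets borel"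
    and moment_integrable: "i + j \<le> 6 \<Longrightarrow> integrable \<mu> (\<lambda>z. fst z ^ i * snd z ^ j)"
    and moment_eq: "i + j \<le> 6 \<Longrightarrow> (\<integral>z. fst z ^ i * snd z ^ j \<partial>\<mu>) = \<beta> i j"
begin

lemma measurable_peval [measurable]: "peval p \<in> borel_measurable \<mu>"
proof -
  have "peval p \<in> borel_measurable borel"
    unfolding peval_def mon_eval_def
    by (intro borel_measurable_continuous_onI continuous_intros)
  then show ?thesis
    by (simp add: measurable_cong_sets[OF sets_rep refl])
qed

lemma
  assumes "i + j \<le> 3"
  shows integrable_monomial_peval: "integrable \<mu> (\<lambda>z. fst z ^ i * snd z ^ j * peval p z)"
    and integral_monomial_peval: "(\<integral>z. fst z ^ i * snd z ^ j * peval p z \<partial>\<mu>) =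
      (\<Sum>m\<in>UNIV. p $ m * \<beta> (i + fst (expo m)) (j + snd (expo m)))"
proof -
  have bound: "i + fst (expo m) + (j + snd (expo m)) \<le> 6" for m
    using assms fst_snd_expo_le[of m] by linarith
  have eq: "(\<lambda>z. fst z ^ i * snd z ^ j * peval p z) = (\<lambda>z. \<Sum>m\<in>UNIV. p $ m *
      (fst z ^ (i + fst (expo m)) * snd z ^ (j + snd (expo m))))"
    by (auto simp: peval_def mon_eval_def sum_distrib_left power_add mult_ac)
  show "integrable \<mu> (\<lambda>z. fst z ^ i * snd z ^ j * peval p z)"
    unfolding eq by (intro Bochner_Integration.integrable_sum integrable_mult_right
      moment_integrable bound)
  show "(\<integral>z. fst z ^ i * snd z ^ j * peval p z \<partial>\<mu>) =
      (\<Sum>m\<in>UNIV. p $ m * \<beta> (i + fst (expo m)) (j + snd (expo m)))"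
    unfolding eq
    by (subst Bochner_Integration.integral_sum)
      (auto intro!: integrable_mult_right moment_integrable bound simp: moment_eq[OF bound])
qed

lemma integral_mon_peval: "(\<integral>z. mon_eval r z * peval p z \<partial>\<mu>) = pXY \<beta> p $ r"
  unfolding mon_eval_def pXY_nth by (rule integral_monomial_peval[OF fst_snd_expo_le])

lemma AE_peval_eq_0:
  assumes "pXY \<beta> p = 0"
  shows "AE z in \<mu>. peval p z = 0"
proof -
  \<comment> \<open>Only one factor \<open>p\<close> is expanded: the integral of each
    \<open>mon_eval r z * peval p z\<close> is an entry of \<open>pXY \<beta> p\<close>, hence
    zero.\<close>
  have eq: "(\<lambda>z. (peval p z)\<^sup>2) = (\<lambda>z. \<Sum>r\<in>UNIV. p $ r * (mon_eval r z * peval p z))"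
    by (auto simp: power2_eq_square peval_def sum_distrib_right mult_ac)
  have int: "integrable \<mu> (\<lambda>z. mon_eval r z * peval p z)" for r
    unfolding mon_eval_def by (rule integrable_monomial_peval[OF fst_snd_expo_le])
  have "integrable \<mu> (\<lambda>z. (peval p z)\<^sup>2)"
    unfolding eq by (intro Bochner_Integration.integrable_sum integrable_mult_right int)
  moreover have "(\<integral>z. (peval p z)\<^sup>2 \<partial>\<mu>) = 0"
    unfolding eq
    by (subst Bochner_Integration.integral_sum)
      (auto intro!: integrable_mult_right int simp: integral_mon_peval assms)
  ultimately show ?thesis
    by (subst (asm) integral_nonneg_eq_0_iff_AE) auto
qed

text \<open>The variety is an intersection of possibly uncountably many zero sets. A finite basis of
  the kernel of \<open>pXY \<beta>\<close> already cuts it out, so finitely many null sets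
  suffice.\<close>

lemma AE_variety: "AE z in \<mu>. z \<in> variety \<beta>"
proof -
  obtain B where B: "B \<subseteq> {p. pXY \<beta> p = 0}" "independent B" "{p. pXY \<beta> p = 0} \<subseteq> span B"
    by (rule basis_exists)
  have "AE z in \<mu>. \<forall>p\<in>B. peval p z = 0"
    using B independent_imp_finite[OF B(2)] by (intro AE_finite_allI AE_peval_eq_0) auto
  then show ?thesis
  proof eventually_elim
    case (elim z)
    have "peval p z = 0" if "p \<in> span B" for p
      using linear_eq_0_on_span[OF linear_peval _ that] elim by blast
    then show ?case
      using B(3) by (auto simp: in_variety_iff)
  qed
qed

text \<open>A polynomial vanishing on the variety vanishes almost everywhere, and the entries of
  \<open>pXY \<beta> p\<close> are integrals of its monomial multiples.\<close>

lemma weakly_consistent: "weakly_consistent \<beta>"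
  unfolding weakly_consistent_def
proof (intro allI impI)
  fix p assume p: "\<forall>z\<in>variety \<beta>. peval p z = 0"
  have "AE z in \<mu>. mon_eval r z * peval p z = 0" for r
    using AE_variety by eventually_elim (simp add: p)
  then have "(\<integral>z. mon_eval r z * peval p z \<partial>\<mu>) = 0" for r
    by (rule integral_eq_zero_AE)
  then show "pXY \<beta> p = 0"
    by (simp add: vec_eq_iff integral_mon_peval)
qed

text \<open>Since the measure lives on the variety, \<open>x^4\<close> may be replaced under the
  integral by the polynomial \<open>poly_B1 a\<close>.\<close>

lemma riesz_test_poly_eq_0:
  assumes "i + j \<le> 2" and a: "\<And>z. z \<in> variety \<beta> \<Longrightarrow> fst z ^ 4 = peval (poly_B1 a) z"
  shows "riesz \<beta> (test_poly i j a) = 0"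
proof -
  have "\<beta> (i + 4) j = (\<integral>z. fst z ^ (i + 4) * snd z ^ j \<partial>\<mu>)"
    using assms(1) by (simp add: moment_eq)
  also have "\<dots> = (\<integral>z. fst z ^ i * snd z ^ j * peval (poly_B1 a) z \<partial>\<mu>)"
  proof (rule integral_cong_AE)
    show "AE z in \<mu>. fst z ^ (i + 4) * snd z ^ j = fst z ^ i * snd z ^ j * peval (poly_B1 a) z"
      using AE_variety by eventually_elim (simp add: a[symmetric] power_add)
  qed (use assms(1) in \<open>auto intro!: borel_measurable_integrable moment_integrable integrable_monomial_peval\<close>)
  also have "\<dots> = (\<Sum>m\<in>UNIV. poly_B1 a $ m * \<beta> (i + fst (expo m)) (j + snd (expo m)))"
    using assms(1) by (intro integral_monomial_peval) auto
  also have "\<dots> = (\<Sum>c\<in>UNIV. a $ c *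
      \<beta> (i + fst (expo (embB1 c))) (j + snd (expo (embB1 c))))"
    unfolding poly_B1_def sum_component scaleR_scaleR sum_distrib_right
    by (subst sum.swap)
      (simp add: axis_def if_distrib[where f = "\<lambda>x. x * _"] if_distrib[where f = "\<lambda>x. _ * x"] cong: if_cong)
  finally show ?thesis
    using assms(1) by (simp add: riesz_test_poly)
qed

end

section \<open>Atomic measures\<close>

lemma has_rep_measure_iff: "has_rep_measure \<beta> \<longleftrightarrow> (\<exists>\<mu>. rep_measure \<beta> \<mu>)"
  unfolding has_rep_measure_def rep_measure_def case_prod_beta' by blast

text \<open>The measure is the sum of point masses \<open>w k\<close> at \<open>pts k\<close>, built
  as the image of a weighted counting measure on the index type; repeated points just add their
  masses.\<close>

lemma atomic_rep_measure:
  fixes pts :: "'k::finite \<Rightarrow> real \<times> real"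
  assumes w: "\<And>k. 0 \<le> w k"
    and moments: "\<And>i j. i + j \<le> 6 \<Longrightarrow> \<beta> i j = (\<Sum>k\<in>UNIV. w k * (fst (pts k) ^ i * snd (pts k) ^ j))"
  shows "rep_measure \<beta> (distr (point_measure UNIV (\<lambda>k. ennreal (w k))) borel pts)"
proof
  have meas: "pts \<in> point_measure UNIV (\<lambda>k. ennreal (w k)) \<rightarrow>\<^sub>M borel"
    by (simp add: measurable_def)
  have mon: "(\<lambda>z :: real \<times> real. fst z ^ i * snd z ^ j) \<in> borel_measurable borel" for i j
    by (intro borel_measurable_continuous_onI continuous_intros)
  fix i j :: nat assume "i + j \<le> 6"
  show "integrable (distr (point_measure UNIV (\<lambda>k. ennreal (w k))) borel pts)
      (\<lambda>z. fst z ^ i * snd z ^ j)"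
    using w by (subst integrable_distr_eq[OF meas mon]) (simp add: integrable_point_measure_finite)
  show "(\<integral>z. fst z ^ i * snd z ^ j \<partial>distr (point_measure UNIV (\<lambda>k. ennreal (w k))) borel pts) = \<beta> i j"
    using w \<open>i + j \<le> 6\<close>
    by (subst integral_distr[OF meas mon]) (simp add: lebesgue_integral_point_measure_finite moments)
qed simp

section \<open>Invertibility of the Vandermonde matrix\<close>

lemma invertible_if_mult_eq_0:
  fixes A :: "real^'n^'m"
  assumes card: "CARD('n) = CARD('m)" and inj: "\<And>u. A *v u = 0 \<Longrightarrow> u = 0"
  shows "invertible A"
proof -
  have lin: "linear ((*v) A)"
    by simp
  have inj': "inj ((*v) A)"
    using inj by (simp add: linear_injective_0[OF lin])
  obtain B where B: "B ** A = mat 1"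
    using inj' matrix_left_invertible_injective[of A] by blast
  \<comment> \<open>Rows and columns have different index types; the equality of their cardinalities
    lets injectivity yield surjectivity by a dimension count.\<close>
  have "dim (range ((*v) A)) = DIM(real^'m)"
    using dim_image_eq[OF lin, of UNIV] inj' card by (simp add: dim_UNIV)
  then have "surj ((*v) A)"
    using dim_eq_full[of "range ((*v) A)"] span_eq_iff[of "range ((*v) A)"]
      linear_subspace_image[OF lin subspace_UNIV] by simp
  then obtain C where C: "A ** C = mat 1"
    using matrix_right_invertible_surjective[of A] by blast
  have "B = B ** (A ** C)"
    by (simp add: C)
  also have "\<dots> = C"
    by (simp add: matrix_mul_assoc B)
  finally show ?thesis
    using B C unfolding invertible_def by blast
qed

lemma
  assumes "invertible A"
  shows matrix_inv_right_rect: "A ** matrix_inv A = mat 1"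
    and matrix_inv_left_rect: "matrix_inv A ** A = mat 1"
  using someI_ex[OF assms[unfolded invertible_def]] by (auto simp: matrix_inv_def)

lemma matrix_vector_matrix_inv:
  fixes A :: "real^'n^'m"
  assumes "invertible A"
  shows "A *v (matrix_inv A *v v) = v"
  by (simp add: matrix_vector_mul_assoc matrix_inv_right_rect[OF assms])

text \<open>A kernel vector is a basic polynomial vanishing at all points of the variety. Weak
  consistency turns it into a relation between the basic columns, and independence makes it
  trivial.\<close>

lemma invertible_W_B1:
  assumes "weakly_consistent \<beta>" "variety \<beta> = range pts"
    and "inj (\<lambda>c. column (embB1 c) (M3 \<beta>))"
    and "independent (range (\<lambda>c. column (embB1 c) (M3 \<beta>)))"
  shows "invertible (W_B1 pts)"
proof (rule invertible_if_mult_eq_0)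
  show "CARD(b1) = CARD(7)"
    by (simp add: CARD_b1)
  let ?f = "\<lambda>c. column (embB1 c) (M3 \<beta>)"
  fix u assume u: "W_B1 pts *v u = 0"
  have "peval (poly_B1 u) (pts k) = 0" for k
    using u by (simp flip: W_B1_mult_nth)
  then have "pXY \<beta> (poly_B1 u) = 0"
    using assms(1,2) by (auto simp: weakly_consistent_def)
  \<comment> \<open>Independence concerns the set of columns, so the coefficients are moved from
    labels to columns along the injective \<open>?f\<close>.\<close>
  then have "(\<Sum>c\<in>UNIV. u $ inv ?f (?f c) *\<^sub>R ?f c) = 0"
    by (simp add: pXY_poly_B1 inv_f_f[OF assms(3)])
  then have sum0: "(\<Sum>v\<in>range ?f. u $ inv ?f v *\<^sub>R v) = 0"
    by (subst sum.reindex[OF assms(3)]) simp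
  have "u $ inv ?f (?f c) = 0" for c
    by (rule independentD[OF assms(4) _ order_refl sum0]) auto
  then show "u = 0"
    by (simp add: vec_eq_iff inv_f_f[OF assms(3)])
qed

section \<open>Reduction of all moments to the basic ones\<close>

lemma column_relation:
  assumes "inj (\<lambda>c. column (embB1 c) (M3 \<beta>))"
    and "span (range (\<lambda>c. column (embB1 c) (M3 \<beta>))) = span (columns (M3 \<beta>))"
  obtains u where "pXY \<beta> (axis m 1 - poly_B1 u) = 0"
proof -
  let ?f = "\<lambda>c. column (embB1 c) (M3 \<beta>)"
  have "column m (M3 \<beta>) \<in> span (range ?f)"
    unfolding assms(2) by (rule span_base) (auto simp: columns_def)
  then obtain g where "column m (M3 \<beta>) = (\<Sum>v\<in>range ?f. g v *\<^sub>R v)"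
    by (auto simp: span_finite)
  also have "\<dots> = (\<Sum>c\<in>UNIV. g (?f c) *\<^sub>R ?f c)"
    by (subst sum.reindex[OF assms(1)]) simp
  finally have "pXY \<beta> (axis m 1 - poly_B1 (\<chi> c. g (?f c))) = 0"
    by (simp add: linear_diff[OF linear_pXY] pXY_axis pXY_poly_B1)
  then show thesis ..
qed

lemma moments_determined:
  fixes pts :: "'k::finite \<Rightarrow> real \<times> real" and w :: "'k \<Rightarrow> real"
  defines "\<gamma> \<equiv> \<lambda>i j. \<Sum>k\<in>UNIV. w k * (fst (pts k) ^ i * snd (pts k) ^ j)"
  assumes pts: "range pts \<subseteq> variety \<beta>"
    and rel: "\<And>m. \<exists>u. pXY \<beta> (axis m 1 - poly_B1 u) = 0"
    and base: "\<And>c. \<beta> (fst (expo (embB1 c))) (snd (expo (embB1 c))) =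
      \<gamma> (fst (expo (embB1 c))) (snd (expo (embB1 c)))"
    and a: "\<And>k. fst (pts k) ^ 4 = peval (poly_B1 a) (pts k)"
    and test: "\<And>i j. i + j \<le> 2 \<Longrightarrow> riesz \<beta> (test_poly i j a) = 0"
    and ij: "i + j \<le> 6"
  shows "\<beta> i j = \<gamma> i j"
  \<comment> \<open>The relation for a non-basic cubic monomial involves \<open>x\<^sup>3\<close>, so it preserves the degree
    but lowers the exponent of \<open>y\<close>; hence the lexicographic measure.\<close>
  using ij
proof (induction "7 * (i + j) + j" arbitrary: i j rule: less_induct)
  case less
  let ?ex = "\<lambda>c. fst (expo (embB1 c))" and ?ey = "\<lambda>c. snd (expo (embB1 c))"
  \<comment> \<open>A relation valid at every atom can be multiplied by any monomial before summing,
    so \<open>\<gamma>\<close> satisfies all its shifts.\<close>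
  have shift: "\<gamma> (s + i') (t + j') = (\<Sum>c\<in>UNIV. u $ c * \<gamma> (s + ?ex c) (t + ?ey c))"
    if "\<And>k. fst (pts k) ^ i' * snd (pts k) ^ j' = peval (poly_B1 u) (pts k)" for u s t i' j'
  proof -
    have "\<gamma> (s + i') (t + j') = (\<Sum>k\<in>UNIV. w k * (fst (pts k) ^ s * snd (pts k) ^ t * 
        peval (poly_B1 u) (pts k)))"
      unfolding \<gamma>_def that[symmetric] by (simp add: power_add mult_ac)
    also have "\<dots> = (\<Sum>c\<in>UNIV. u $ c * \<gamma> (s + ?ex c) (t + ?ey c))"
      unfolding \<gamma>_def peval_poly_B1 sum_distrib_left
      by (subst sum.swap) (simp add: mon_eval_def power_add mult_ac)
    finally show ?thesis .
  qed
  \<comment> \<open>The monomial is the cubic \<open>m\<close> times a cofactor \<open>r\<close>.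
    Row \<open>r\<close> of the column relation for \<open>m\<close> gives \<open>\<beta>\<close>
    the same recurrence that \<open>shift\<close> gives \<open>\<gamma>\<close>.\<close>
  have reduce: "\<beta> i j = \<gamma> i j"
    if ij: "i = fst (expo r) + fst (expo m)" "j = snd (expo r) + snd (expo m)"
      and m: "m \<in> {M_X2Y, M_XY2, M_Y3}" for r m
  proof -
    obtain u where u: "pXY \<beta> (axis m 1 - poly_B1 u) = 0"
      using rel by blast
    have "mon_eval m (pts k) = peval (poly_B1 u) (pts k)" for k
    proof -
      have "peval (axis m 1 - poly_B1 u) (pts k) = 0"
        using pts u in_variety_iff by blast
      then show ?thesis
        by (simp add: linear_diff[OF linear_peval] peval_axis)
    qed
    then have \<gamma>: "\<gamma> i j = (\<Sum>c\<in>UNIV. u $ c * \<gamma> (fst (expo r) + ?ex c) (snd (expo r) + ?ey c))"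
      unfolding ij by (intro shift) (simp add: mon_eval_def)
    have "pXY \<beta> (axis m 1) $ r = pXY \<beta> (poly_B1 u) $ r"
      using u by (simp add: linear_diff[OF linear_pXY])
    then have \<beta>: "\<beta> i j = (\<Sum>c\<in>UNIV. u $ c * \<beta> (fst (expo r) + ?ex c) (snd (expo r) + ?ey c))"
      by (simp add: pXY_axis pXY_poly_B1 column_def M3_def ij)
    have "\<beta> (fst (expo r) + ?ex c) (snd (expo r) + ?ey c) =
        \<gamma> (fst (expo r) + ?ex c) (snd (expo r) + ?ey c)" for c
    proof (rule less.hyps)
      \<comment> \<open>For \<open>c \<noteq> B_X3\<close> the degree drops, and the weight 7
        outweighs a gain of at most 1 in the exponent of \<open>y\<close>.\<close>
      show "7 * (fst (expo r) + ?ex c + (snd (expo r) + ?ey c)) + (snd (expo r) + ?ey c)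
          < 7 * (i + j) + j"
        using m by (cases c) (auto simp: ij)
      show "fst (expo r) + ?ex c + (snd (expo r) + ?ey c) \<le> 6"
        using fst_snd_expo_le[of r] fst_snd_expo_le[of "embB1 c"] by linarith
    qed
    then show ?thesis
      by (simp add: \<beta> \<gamma>)
  qed
  show ?case
  proof (cases "j = 0 \<and> 4 \<le> i")
    case True
    \<comment> \<open>No non-basic cubic divides a pure power of \<open>x\<close>; here the test
      condition with multiplier \<open>x^s\<close> lowers the degree.\<close>
    define s where "s = i - 4"
    have s: "i = s + 4" "s \<le> 2" "j = 0"
      using True less.prems by (auto simp: s_def)
    have \<gamma>: "\<gamma> (s + 4) (0 + 0) = (\<Sum>c\<in>UNIV. a $ c * \<gamma> (s + ?ex c) (0 + ?ey c))"
      by (rule shift) (simp add: a)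
    have \<beta>: "\<beta> (s + 4) 0 = (\<Sum>c\<in>UNIV. a $ c * \<beta> (s + ?ex c) (0 + ?ey c))"
      using test[of s 0] s by (simp add: riesz_test_poly)
    have "\<beta> (s + ?ex c) (0 + ?ey c) = \<gamma> (s + ?ex c) (0 + ?ey c)" for c
      by (rule less.hyps) (use s in \<open>cases c; auto\<close>)+
    then show ?thesis
      using \<beta> \<gamma> s by simp
  next
    case False
    \<comment> \<open>Any other monomial is basic or divisible by a non-basic cubic. In the latter
      case \<open>i + j \<le> 6\<close> leaves a cofactor of degree at most 3, which labels a
      row.\<close>
    consider (basic) c where "i = ?ex c" "j = ?ey c"
      | (cubic) r m where "i = fst (expo r) + fst (expo m)" "j = snd (expo r) + snd (expo m)"
        "m \<in> {M_X2Y, M_XY2, M_Y3}"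
    proof -
      have split: thesis
        if m: "m \<in> {M_X2Y, M_XY2, M_Y3}" "fst (expo m) \<le> i" "snd (expo m) \<le> j" for m
      proof -
        have "i - fst (expo m) + (j - snd (expo m)) \<le> 3"
          using m less.prems by auto
        then obtain r where "expo r = (i - fst (expo m), j - snd (expo m))"
          by (rule expo_surj)
        then show thesis
          using m by (intro cubic[of r m]) auto
      qed
      have "3 \<le> j \<or> 2 \<le> j \<and> 1 \<le> i \<or> 1 \<le> j \<and> 2 \<le> i \<or> i = 0 \<and> j = 0 \<or>
          i = 1 \<and> j = 0 \<or> i = 0 \<and> j = 1 \<or> i = 2 \<and> j = 0 \<or> i = 1 \<and> j = 1 \<or>
          i = 0 \<and> j = 2 \<or> i = 3 \<and> j = 0"
        using False by presburger
      then consider "3 \<le> j" | "2 \<le> j" "1 \<le> i" | "1 \<le> j" "2 \<le> i" | "i = 0" "j = 0" | "i = 1" "j = 0"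
        | "i = 0" "j = 1" | "i = 2" "j = 0" | "i = 1" "j = 1" | "i = 0" "j = 2" | "i = 3" "j = 0"
        by blast
      then show thesis
      proof cases
        case 1 then show ?thesis using split[of M_Y3] by simp
      next
        case 2 then show ?thesis using split[of M_XY2] by simp
      next
        case 3 then show ?thesis using split[of M_X2Y] by simp
      next
        case 4 then show ?thesis using basic[of B_1] by simp
      next
        case 5 then show ?thesis using basic[of B_X] by simp
      next
        case 6 then show ?thesis using basic[of B_Y] by simp
      next
        case 7 then show ?thesis using basic[of B_X2] by simp
      next
        case 8 then show ?thesis using basic[of B_XY] by simp
      next
        case 9 then show ?thesis using basic[of B_Y2] by simp
      next
        case 10 then show ?thesis using basic[of B_X3] by simp
      qed
    qed
    then show ?thesis
    proof cases
      case (basic c)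
      show ?thesis unfolding basic by (rule base)
    next
      case (cubic r m)
      then show ?thesis by (rule reduce)
    qed
  qed
qed

section \<open>Nonnegativity of the weights\<close>

lemma weights_nonneg:
  fixes pts :: "7 \<Rightarrow> real \<times> real"
  assumes psd: "psd_mat (M3 \<beta>)" and inv: "invertible (W_B1 pts)"
    and moments: "\<And>i j. i + j \<le> 6 \<Longrightarrow>
      \<beta> i j = (\<Sum>k\<in>UNIV. w k * (fst (pts k) ^ i * snd (pts k) ^ j))"
  shows "0 \<le> w k"
proof -
  \<comment> \<open>Column \<open>k\<close> of the inverse holds the coefficients of the Lagrange
    polynomial that is 1 at \<open>pts k\<close> and 0 at the other points.\<close>
  define p where "p = poly_B1 (matrix_inv (W_B1 pts) *v axis k 1)"
  have p: "peval p (pts l) = (if l = k then 1 else 0)" for l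
    by (simp add: p_def W_B1_mult_nth[symmetric] matrix_vector_matrix_inv[OF inv] axis_def)
  have bound: "fst (expo r) + fst (expo m) + (snd (expo r) + snd (expo m)) \<le> 6" for r m
    using fst_snd_expo_le[of r] fst_snd_expo_le[of m] by linarith
  have "(M3 \<beta> *v p) $ r = (\<Sum>l\<in>UNIV. w l * (mon_eval r (pts l) * peval p (pts l)))" for r
  proof -
    have "(M3 \<beta> *v p) $ r = (\<Sum>m\<in>UNIV. \<Sum>l\<in>UNIV. w l * (mon_eval r (pts l) * 
        (p $ m * mon_eval m (pts l))))"
      by (simp add: matrix_vector_mult_def M3_def moments[OF bound] mon_eval_def power_add
          sum_distrib_right sum_distrib_left mult_ac)
    also have "\<dots> = (\<Sum>l\<in>UNIV. w l * (mon_eval r (pts l) * peval p (pts l)))"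
      by (subst sum.swap) (simp add: peval_def sum_distrib_left)
    finally show ?thesis .
  qed
  \<comment> \<open>The quadratic form is the atomic functional applied to the square of
    \<open>p\<close>, of which only the term \<open>w k\<close> survives.\<close>
  then have "p \<bullet> (M3 \<beta> *v p) =
      (\<Sum>r\<in>UNIV. \<Sum>l\<in>UNIV. w l * peval p (pts l) * (p $ r * mon_eval r (pts l)))"
    by (simp add: inner_vec_def sum_distrib_left mult_ac)
  also have "\<dots> = (\<Sum>l\<in>UNIV. w l * peval p (pts l) * peval p (pts l))"
    by (subst sum.swap) (simp add: peval_def[of p] sum_distrib_left)
  also have "\<dots> = w k"
    by (simp add: p if_distrib[where f = "\<lambda>x. _ * x"] cong: if_cong)
  finally show ?thesis
    using psd unfolding psd_mat_def by metis
qed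

section \<open>Equivalence of a representing measure with the two conditions\<close>

theorem theorem4p2:
  fixes \<beta> :: "nat \<Rightarrow> nat \<Rightarrow> real" and pts :: "7 \<Rightarrow> real \<times> real"
  assumes "psd_mat (M3 \<beta>)"
    and "pd_mat (M2 \<beta>)"
    and "rank (M3 \<beta>) = 7"
    and "card (variety \<beta>) = 7"
    and "variety \<beta> = range pts"
    and "inj (\<lambda>c. column (embB1 c) (M3 \<beta>))"
    and "independent (range (\<lambda>c. column (embB1 c) (M3 \<beta>)))"
    and "span (range (\<lambda>c. column (embB1 c) (M3 \<beta>))) = span (columns (M3 \<beta>))"
  shows "has_rep_measure \<beta> \<longleftrightarrow>
     weakly_consistent \<beta> \<and>
     (\<forall>i j. i + j \<le> 2 \<longrightarrow>
        riesz \<beta> (test_poly i j (matrix_inv (W_B1 pts) *v (\<chi> k. fst (pts k) ^ 4))) = 0)"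
proof -
  let ?W = "W_B1 pts"
  define a where "a = matrix_inv ?W *v (\<chi> k. fst (pts k) ^ 4)"
  \<comment> \<open>That \<open>a\<close> interpolates \<open>x^4\<close> rests on the invertibility
    of \<open>?W\<close>, hence the premise of weak consistency, which both directions
    supply.\<close>
  have a: "fst (pts k) ^ 4 = peval (poly_B1 a) (pts k)" if "weakly_consistent \<beta>" for k
    using invertible_W_B1[OF that assms(5-7)]
    by (simp add: a_def matrix_vector_matrix_inv flip: W_B1_mult_nth)
  show ?thesis
    unfolding a_def[symmetric]
  proof
    assume "has_rep_measure \<beta>"
    then obtain \<mu> where "rep_measure \<beta> \<mu>"
      by (auto simp: has_rep_measure_iff)
    then interpret rep_measure \<beta> \<mu> .
    show "weakly_consistent \<beta> \<and> (\<forall>i j. i + j \<le> 2 \<longrightarrow> riesz \<beta> (test_poly i j a) = 0)"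
    proof (intro conjI allI impI weakly_consistent riesz_test_poly_eq_0)
      show "fst z ^ 4 = peval (poly_B1 a) z" if "z \<in> variety \<beta>" for z
        using that a[OF weakly_consistent] assms(5) by force
    qed
  next
    assume asm: "weakly_consistent \<beta> \<and> (\<forall>i j. i + j \<le> 2 \<longrightarrow> riesz \<beta> (test_poly i j a) = 0)"
    have inv: "invertible ?W"
      using asm by (intro invertible_W_B1[OF _ assms(5-7)]) simp
    define b :: "real^b1" where
      "b = (\<chi> c. \<beta> (fst (expo (embB1 c))) (snd (expo (embB1 c))))"
    \<comment> \<open>These weights solve the seven basic moment equations; their signs follow only
      after all moments up to degree 6 are matched.\<close>
    define w where "w = b v* matrix_inv ?W"
    have "w v* ?W = b"
      by (simp add: w_def vector_matrix_mul_assoc matrix_inv_left_rect[OF inv])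
    then have base: "\<beta> (fst (expo (embB1 c))) (snd (expo (embB1 c))) =
        (\<Sum>k\<in>UNIV. w $ k *
          (fst (pts k) ^ fst (expo (embB1 c)) * snd (pts k) ^ snd (expo (embB1 c))))" for c
      by (simp add: vec_eq_iff b_def vector_matrix_mult_def W_B1_def mon_eval_def mult.commute)
    have moments: "\<beta> i j = (\<Sum>k\<in>UNIV. w $ k * (fst (pts k) ^ i * snd (pts k) ^ j))"
      if "i + j \<le> 6" for i j
    proof (rule moments_determined[OF _ _ base a _ that])
      show "\<exists>u. pXY \<beta> (axis m 1 - poly_B1 u) = 0" for m
        using column_relation[OF assms(6,8)] by blast
    qed (use asm assms(5) in auto)
    have "rep_measure \<beta> (distr (point_measure UNIV (\<lambda>k. ennreal (w $ k))) borel pts)"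
      by (intro atomic_rep_measure weights_nonneg[OF assms(1) inv] moments)
    then show "has_rep_measure \<beta>"
      by (auto simp: has_rep_measure_iff)
  qed
qed

end
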